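(* Every strongly extensive digraph is Cantor, i.e. Cantor's theorem holds in it.
   Context: A digraph is $D=\langle V,E\rangle$ with $V$ a nonempty set and $E\subseteq V\times V$; $uEv$ means $\langle u,v\rangle\in E$. $N(u)=\{v\in V: vEu\}$ is the set of in-neighbors of $u$; elements of $N(u)$ are the $D$-elements of $u$. $D$ is strongly extensive if for every vertex $u\in V$ and every set $A\subseteq N(u)$ there exists a vertex $v\in V$ such that $N(v)=A$. For vertices of $D$: $u$ is a $D$-subset of $v$ ($u\subset_D v$) if $N(u)\subseteq N(v)$; $u$ is the singleton $\{v\}_D$ if $u$ is the only vertex with $N(u)=\{v\}$; $u$ is the doubleton $\{v,w\}_D$ if $u$ is the only vertex with $N(u)=\{v,w\}$; $u$ is an ordered pair $\langle v,w\rangle_D$ if $u=\{\{v\}_D,\{v,w\}_D\}_D$ (i.e. there are vertices $s,t$ such that $s$ is the singleton $\{v\}_D$, $t$ is the doubleton $\{v,w\}_D$ and $u$ is the doubleton $\{s,t\}_D$). $u$ is a $D$-relation from $v$ to $P(v)$ if every $D$-element of $u$ is an ordered pair $\langle w,w'\rangle_D$ with $wEv$ and $w'\subset_D v$. $u$ is a $D$-function from $v$ to $P(v)$ if it is a $D$-relation from $v$ to $P(v)$ and for every $D$-element $w$ of $v$ there is exactly one ordered pair $\langle w,w'\rangle_D$ that is a $D$-element of $u$. $u$ is a $D$-surjection from $v$ to $P(v)$ if it is a $D$-function from $v$ to $P(v)$ and for every $w'\subset_D v$ there is at least one ordered pair $\langle w,w'\rangle_D$ that is a $D$-element of $u$.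 Cantor's theorem holds in $D$ ($D$ is Cantor) if for no vertex $u\in V$ there exists a vertex $v\in V$ that is a $D$-surjection from $u$ to $P(u)$. *)

theory Defs
  imports "Graph_Theory.Pair_Digraph"
begin

text \<open>
  Digraphs are those of \<open>pair_wf_digraph\<close>: loops are allowed and the vertex set may be
  infinite. The vertex set may still be empty, so nonemptiness is added here.
\<close>

definition nonempty_digraph :: "'a pair_pre_digraph \<Rightarrow> bool" where
  "nonempty_digraph D \<longleftrightarrow> pair_wf_digraph D \<and> pverts D \<noteq> {}"

definition in_nbrs :: "'a pair_pre_digraph \<Rightarrow> 'a \<Rightarrow> 'a set" where
  "in_nbrs D u = {v \<in> pverts D. (v, u) \<in> parcs D}"

definition strongly_extensive :: "'a pair_pre_digraph \<Rightarrow> bool" where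
  "strongly_extensive D \<longleftrightarrow>
    (\<forall>u \<in> pverts D. \<forall>A. A \<subseteq> in_nbrs D u \<longrightarrow> (\<exists>v \<in> pverts D. in_nbrs D v = A))"

definition D_subset :: "'a pair_pre_digraph \<Rightarrow> 'a \<Rightarrow> 'a \<Rightarrow> bool" where
  "D_subset D u v \<longleftrightarrow> in_nbrs D u \<subseteq> in_nbrs D v"

text \<open>
  Extensionality is not assumed, so different vertices may have the same in-neighbours;
  being a singleton or a doubleton includes being the only such vertex.
\<close>

definition is_D_singleton :: "'a pair_pre_digraph \<Rightarrow> 'a \<Rightarrow> 'a \<Rightarrow> bool" where
  "is_D_singleton D u v \<longleftrightarrow>
    u \<in> pverts D \<and> in_nbrs D u = {v} \<and> (\<forall>x \<in> pverts D. in_nbrs D x = {v} \<longrightarrow> x = u)"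

definition is_D_doubleton :: "'a pair_pre_digraph \<Rightarrow> 'a \<Rightarrow> 'a \<Rightarrow> 'a \<Rightarrow> bool" where
  "is_D_doubleton D u v w \<longleftrightarrow>
    u \<in> pverts D \<and> in_nbrs D u = {v, w} \<and> (\<forall>x \<in> pverts D. in_nbrs D x = {v, w} \<longrightarrow> x = u)"

definition is_D_pair :: "'a pair_pre_digraph \<Rightarrow> 'a \<Rightarrow> 'a \<Rightarrow> 'a \<Rightarrow> bool" where
  "is_D_pair D u v w \<longleftrightarrow>
    (\<exists>s \<in> pverts D. \<exists>t \<in> pverts D.
      is_D_singleton D s v \<and> is_D_doubleton D t v w \<and> is_D_doubleton D u s t)"

text \<open>In the following three definitions, \<open>u\<close> is a relation, function or surjection
  from \<open>v\<close> to \<open>P(v)\<close>.\<close>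

definition is_D_relation :: "'a pair_pre_digraph \<Rightarrow> 'a \<Rightarrow> 'a \<Rightarrow> bool" where
  "is_D_relation D u v \<longleftrightarrow>
    (\<forall>p \<in> in_nbrs D u. \<exists>w \<in> in_nbrs D v. \<exists>w' \<in> pverts D. D_subset D w' v \<and> is_D_pair D p w w')"

definition is_D_function :: "'a pair_pre_digraph \<Rightarrow> 'a \<Rightarrow> 'a \<Rightarrow> bool" where
  "is_D_function D u v \<longleftrightarrow>
    is_D_relation D u v \<and>
    (\<forall>w \<in> in_nbrs D v. \<exists>!p. p \<in> in_nbrs D u \<and> (\<exists>w' \<in> pverts D. is_D_pair D p w w'))"

definition is_D_surjection :: "'a pair_pre_digraph \<Rightarrow> 'a \<Rightarrow> 'a \<Rightarrow> bool" where
  "is_D_surjection D u v \<longleftrightarrow>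
    is_D_function D u v \<and>
    (\<forall>w' \<in> pverts D. D_subset D w' v \<longrightarrow>
      (\<exists>p \<in> in_nbrs D u. \<exists>w \<in> pverts D. is_D_pair D p w w'))"

definition cantor_digraph :: "'a pair_pre_digraph \<Rightarrow> bool" where
  "cantor_digraph D \<longleftrightarrow> \<not> (\<exists>u \<in> pverts D. \<exists>v \<in> pverts D. is_D_surjection D v u)"

end

theory Submission
  imports Defs
begin

text \<open>Cantor's diagonal argument inside \<open>D\<close>. Given a surjection \<open>v\<close>
  from \<open>u\<close> to \<open>P(u)\<close>, strong extensiveness makes the diagonal subset of
  \<open>in_nbrs D u\<close> the in-neighbourhood of some vertex \<open>a\<close>. A preimage
  \<open>w\<close> of \<open>a\<close> then lies in that set iff it does not. Speaking of the value
  at \<open>w\<close> requires coordinates of pairs to be unique, which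
  \<open>is_D_pair_inject\<close> supplies.\<close>

lemma singleton_doubleton_inject:
  assumes "{{v}, {v, w}} = {{v'}, {v', w'}}"
  shows "v = v' \<and> w = w'"
  using assms unfolding doubleton_eq_iff[of "{v}"] by (auto simp: doubleton_eq_iff)

text \<open>Taking in-neighbourhoods at two levels turns a pair of \<open>D\<close> into the
  Kuratowski pair of actual sets, so injectivity carries over.\<close>

lemma is_D_pair_in_nbrs:
  assumes "is_D_pair D p v w"
  shows "in_nbrs D ` in_nbrs D p = {{v}, {v, w}}"
proof -
  obtain s t where "in_nbrs D s = {v}" "in_nbrs D t = {v, w}" "in_nbrs D p = {s, t}"
    using assms unfolding is_D_pair_def is_D_singleton_def is_D_doubleton_def by blast
  then show ?thesis
    by simp
qed

lemma is_D_pair_inject: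
  assumes "is_D_pair D p v w" and "is_D_pair D p v' w'"
  shows "v = v'" and "w = w'"
proof -
  have "{{v}, {v, w}} = {{v'}, {v', w'}}"
    using is_D_pair_in_nbrs[OF assms(1)] is_D_pair_in_nbrs[OF assms(2)] by (rule trans[OF sym])
  then have "v = v' \<and> w = w'"
    by (rule singleton_doubleton_inject)
  then show "v = v'" and "w = w'"
    by blast+
qed

theorem mainTheorem3:
  fixes D :: "'a pair_pre_digraph"
  assumes "nonempty_digraph D"
    and "strongly_extensive D"
  shows "cantor_digraph D"
  unfolding cantor_digraph_def
proof
  assume "\<exists>u \<in> pverts D. \<exists>v \<in> pverts D. is_D_surjection D v u"
  then obtain u v where u: "u \<in> pverts D" and surj: "is_D_surjection D v u"
    by blast
  then have func: "is_D_function D v u" and rel: "is_D_relation D v u"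
    unfolding is_D_surjection_def is_D_function_def by auto
  define A where
    "A = {w \<in> in_nbrs D u. \<exists>p \<in> in_nbrs D v. \<exists>w' \<in> pverts D. is_D_pair D p w w' \<and> w \<notin> in_nbrs D w'}"
  have "A \<subseteq> in_nbrs D u"
    unfolding A_def by blast
  \<comment> \<open>Other vertices may share the in-neighbourhood \<open>A\<close>; one of them is
    fixed as the target.\<close>
  then obtain a where a: "a \<in> pverts D" "in_nbrs D a = A" "D_subset D a u"
    using assms(2) u unfolding strongly_extensive_def D_subset_def by metis
  then obtain p w where p: "p \<in> in_nbrs D v" "is_D_pair D p w a"
    using surj unfolding is_D_surjection_def by blast
  \<comment> \<open>Surjectivity only makes \<open>w\<close> a vertex; the relation clause puts some
    first coordinate of \<open>p\<close> in \<open>in_nbrs D u\<close>, and that coordinate is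
    \<open>w\<close>.\<close>
  then have w: "w \<in> in_nbrs D u"
    using rel is_D_pair_inject(1) unfolding is_D_relation_def by metis
  \<comment> \<open>The function clause makes the pair over \<open>w\<close> unique; injectivity
    turns this into uniqueness of its second coordinate.\<close>
  have value_at_w: "w' = a"
    if "q \<in> in_nbrs D v" "w' \<in> pverts D" "is_D_pair D q w w'" for q w'
  proof -
    have "q = p"
      using func w that p a(1) unfolding is_D_function_def by blast
    then show ?thesis
      using is_D_pair_inject(2) that(3) p(2) by metis
  qed
  have "w \<in> A \<longleftrightarrow> w \<notin> A"
  proof
    assume "w \<in> A"
    then show "w \<notin> A"
      using value_at_w a(2) unfolding A_def by blast
  next
    assume "w \<notin> A"
    then show "w \<in> A"
      using w p a(1,2) unfolding A_def by blast
  qed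
  then show False
    by blast
qed

end
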